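(* Let $f \in \operatorname{Perm}$ and $\Pi = \operatorname{Part} f$. The following are equivalent: (a) $\mathrm{CF}(f) = \{x : |[x]_f| < \infty\}$ is decidable; (b) there is a total recursive function $\rho$ with $\rho(x) = 0$ if $|P(x,\Pi)| = \infty$ and $\rho(x) = |P(x,\Pi)|$ otherwise; (c) $f$ is effectively conjugate to its semi-normal form (i.e. the semi-normal form is recursive and conjugate to $f$ via some element of $\mathcal{G}$).
   Context: $\mathcal{G}$ is the group of recursive permutations of $\mathbb{N}$; $[x]_f=\{f^k(x):k\in\mathbb{Z}\}$, $\operatorname{Part} f = \{[x]_f\}$, $P(x,\Pi)$ the block of $x$. $\operatorname{Perm}$ is the set of $f\in\mathcal{G}$ for which $x\equiv_f x'$ (i.e. $x'\in[x]_f$) is decidable. Let $\delta:\mathbb{Z}\to\mathbb{N}$, $\delta(0)=0$, $\delta(k)=2k$ ($k>0$), $\delta(k)=-2k-1$ ($k<0$). A permutation is semi-normal if every infinite cycle with least element $a_0$ has $j\mapsto f^{\delta^{-1}(j)}(a_0)$ strictly increasing for all $j\ge 0$, and every finite cycle of length $n$ with least element $a_0$ has $j\mapsto f^j(a_0)$ strictly increasing for $0\le j<n$. For every permutation $f$ there is a unique (possibly non-recursive) semi-normal permutation with the same cycles, its semi-normal form. *)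

theory Defs
  imports Main
begin

text \<open>
  Partial recursive functions, given by \<open>\<mu>\<close>-recursive programs: \<open>computes p xs y\<close> means that
  the program \<open>p\<close> halts on the arguments \<open>xs\<close> with value \<open>y\<close>. Programs carry no arity. A program
  applied to an argument list of the wrong shape has no value. Recursion and minimisation act on
  the first argument.
\<close>

datatype recprog =
    RZero
  | RSucc
  | RProj nat
  | RComp recprog "recprog list"
  | RPrim recprog recprog
  | RMu recprog

inductive computes :: "recprog \<Rightarrow> nat list \<Rightarrow> nat \<Rightarrow> bool" where
  zero: "computes RZero xs 0"
| succ: "computes RSucc [x] (Suc x)"
| proj: "i < length xs \<Longrightarrow> computes (RProj i) xs (xs ! i)"
| comp: "list_all2 (\<lambda>q y. computes q xs y) qs ys \<Longrightarrow> computes p ys z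
          \<Longrightarrow> computes (RComp p qs) xs z"
| prim_0: "computes p xs z \<Longrightarrow> computes (RPrim p q) (0 # xs) z"
| prim_Suc: "computes (RPrim p q) (n # xs) y \<Longrightarrow> computes q (n # y # xs) z
          \<Longrightarrow> computes (RPrim p q) (Suc n # xs) z"
| mu: "computes p (n # xs) 0 \<Longrightarrow> (\<And>m. m < n \<Longrightarrow> \<exists>k. computes p (m # xs) (Suc k))
          \<Longrightarrow> computes (RMu p) xs n"

definition total_recursive :: "(nat \<Rightarrow> nat) \<Rightarrow> bool" where
  "total_recursive f \<longleftrightarrow> (\<exists>p. \<forall>x. computes p [x] (f x))"

definition total_recursive2 :: "(nat \<Rightarrow> nat \<Rightarrow> nat) \<Rightarrow> bool" where
  "total_recursive2 f \<longleftrightarrow> (\<exists>p. \<forall>x y. computes p [x, y] (f x y))"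

definition decidable_set :: "nat set \<Rightarrow> bool" where
  "decidable_set A \<longleftrightarrow> total_recursive (\<lambda>x. if x \<in> A then 1 else 0)"

definition decidable_rel :: "(nat \<Rightarrow> nat \<Rightarrow> bool) \<Rightarrow> bool" where
  "decidable_rel R \<longleftrightarrow> total_recursive2 (\<lambda>x y. if R x y then 1 else 0)"

definition rec_perms :: "(nat \<Rightarrow> nat) set" where
  "rec_perms = {f. bij f \<and> total_recursive f}"

definition int_iter :: "('a \<Rightarrow> 'a) \<Rightarrow> int \<Rightarrow> 'a \<Rightarrow> 'a" where
  "int_iter f k = (if 0 \<le> k then f ^^ nat k else inv f ^^ nat (- k))"

definition perm_cycle :: "('a \<Rightarrow> 'a) \<Rightarrow> 'a \<Rightarrow> 'a set" where
  "perm_cycle f x = {int_iter f k x | k. True}"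

definition Part :: "('a \<Rightarrow> 'a) \<Rightarrow> 'a set set" where
  "Part f = {perm_cycle f x | x. True}"

text \<open>\<open>Q\<close> is meant to be a partition, so that the block is uniquely determined.\<close>

definition block_of :: "'a \<Rightarrow> 'a set set \<Rightarrow> 'a set" where
  "block_of x Q = (THE B. B \<in> Q \<and> x \<in> B)"

definition dec_perms :: "(nat \<Rightarrow> nat) set" where
  "dec_perms = {f \<in> rec_perms. decidable_rel (\<lambda>x x'. x' \<in> perm_cycle f x)}"

definition CF :: "('a \<Rightarrow> 'a) \<Rightarrow> 'a set" where
  "CF f = {x. finite (perm_cycle f x)}"

definition zdelta :: "int \<Rightarrow> nat" where
  "zdelta k = (if 0 \<le> k then nat (2 * k) else nat (- 2 * k - 1))"

text \<open>
  \<open>zdelta\<close> is a bijection, so \<open>inv zdelta\<close> is its genuine inverse. A semi-normal permutation need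
  not be recursive.
\<close>

definition semi_normal :: "(nat \<Rightarrow> nat) \<Rightarrow> bool" where
  "semi_normal g \<longleftrightarrow> bij g \<and>
     (\<forall>C \<in> Part g. let a = (LEAST x. x \<in> C) in
        (infinite C \<longrightarrow> strict_mono (\<lambda>j. int_iter g (inv zdelta j) a)) \<and>
        (finite C \<longrightarrow> strict_mono_on {0..<card C} (\<lambda>j. (g ^^ j) a)))"

text \<open>Every permutation of the natural numbers has exactly one semi-normal form.\<close>

definition semi_normal_form :: "(nat \<Rightarrow> nat) \<Rightarrow> nat \<Rightarrow> nat" where
  "semi_normal_form f = (THE g. semi_normal g \<and> Part g = Part f)"

definition effectively_conjugate :: "(nat \<Rightarrow> nat) \<Rightarrow> (nat \<Rightarrow> nat) \<Rightarrow> bool" where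
  "effectively_conjugate f g \<longleftrightarrow>
     f \<in> rec_perms \<and> g \<in> rec_perms \<and> (\<exists>h \<in> rec_perms. g = inv h \<circ> f \<circ> h)"

end

theory Submission
  imports Defs "HOL-Library.Infinite_Set"
begin

text \<open>
  Let \<open>h\<close> send the element of rank \<open>j\<close> of a cycle \<open>C\<close> of \<open>f\<close> with least element \<open>a\<close> to
  \<open>f\<^sup>j(a)\<close> if \<open>C\<close> is finite, and to the \<open>j\<close>-th term of \<open>a, f\<^sup>-\<^sup>1(a), f(a), f\<^sup>-\<^sup>2(a), \<dots>\<close>
  otherwise. Then \<open>h\<close> permutes every cycle, and the semi-normal form of \<open>f\<close> is \<open>h\<^sup>-\<^sup>1 \<circ> f \<circ> h\<close>.
  If the finiteness of cycles is decidable, then \<open>h\<close> is recursive, because least elements and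
  ranks are computable from the decidable cycle relation.
  Conversely, a recursive semi-normal form \<open>g\<close> decides finiteness: \<open>g\<close> maps the least element
  of a cycle to the element of rank 2 if the cycle is infinite, and to rank at most 1 otherwise.
\<close>

section \<open>Recursive functions\<close>

text \<open>Programs carry no arity, so the length is fixed from outside. Values of \<open>F\<close>
  on lists of other lengths are unconstrained, so \<open>F\<close> may be any term in the entries
  \<open>xs ! i\<close>.\<close>

definition recursive :: "nat \<Rightarrow> (nat list \<Rightarrow> nat) \<Rightarrow> bool" where
  "recursive n F \<longleftrightarrow> (\<exists>p. \<forall>xs. length xs = n \<longrightarrow> computes p xs (F xs))"

lemma total_recursive_iff: "total_recursive f \<longleftrightarrow> recursive 1 (\<lambda>xs. f (xs ! 0))"
proof -
  have "(\<forall>xs. length xs = 1 \<longrightarrow> P xs) \<longleftrightarrow> (\<forall>x. P [x])" for P :: "nat list \<Rightarrow> bool"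
    by (auto simp: length_Suc_conv)
  then show ?thesis by (simp add: total_recursive_def recursive_def)
qed

lemma total_recursive2_iff: "total_recursive2 f \<longleftrightarrow> recursive 2 (\<lambda>xs. f (xs ! 0) (xs ! 1))"
proof -
  have "(\<forall>xs. length xs = 2 \<longrightarrow> P xs) \<longleftrightarrow> (\<forall>x y. P [x, y])" for P :: "nat list \<Rightarrow> bool"
    by (auto simp: length_Suc_conv numeral_2_eq_2)
  then show ?thesis by (simp add: total_recursive2_def recursive_def)
qed

lemma recursive_cong:
  "recursive n F \<Longrightarrow> (\<And>xs. length xs = n \<Longrightarrow> F xs = G xs) \<Longrightarrow> recursive n G"
  unfolding recursive_def by metis

lemma recursive_nth: "i < n \<Longrightarrow> recursive n (\<lambda>xs. xs ! i)"
  unfolding recursive_def by (metis computes.proj)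

lemma recursive_comp:
  assumes "recursive (length Gs) F" "\<And>G. G \<in> set Gs \<Longrightarrow> recursive n G"
  shows "recursive n (\<lambda>xs. F (map (\<lambda>G. G xs) Gs))"
proof -
  obtain p where p: "\<And>ys. length ys = length Gs \<Longrightarrow> computes p ys (F ys)"
    using assms(1) unfolding recursive_def by blast
  obtain q where q: "\<And>G xs. G \<in> set Gs \<Longrightarrow> length xs = n \<Longrightarrow> computes (q G) xs (G xs)"
    using assms(2) unfolding recursive_def by metis
  have "computes (RComp p (map q Gs)) xs (F (map (\<lambda>G. G xs) Gs))" if "length xs = n" for xs
  proof (rule computes.comp)
    show "list_all2 (\<lambda>q y. computes q xs y) (map q Gs) (map (\<lambda>G. G xs) Gs)"
      using q that by (simp add: list_all2_conv_all_nth)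
  qed (simp add: p)
  then show ?thesis unfolding recursive_def by blast
qed

lemma recursive_app1:
  assumes "total_recursive g" "recursive n F"
  shows "recursive n (\<lambda>xs. g (F xs))"
  using recursive_comp[of "[F]" "\<lambda>xs. g (xs ! 0)" n] assms by (simp add: total_recursive_iff)

lemma recursive_app2:
  assumes "total_recursive2 g" "recursive n F" "recursive n G"
  shows "recursive n (\<lambda>xs. g (F xs) (G xs))"
  using recursive_comp[of "[F, G]" "\<lambda>xs. g (xs ! 0) (xs ! 1)" n] assms
  by (auto simp add: total_recursive2_iff numeral_2_eq_2)

lemma recursive_Suc: "recursive n F \<Longrightarrow> recursive n (\<lambda>xs. Suc (F xs))"
  by (rule recursive_app1) (auto simp: total_recursive_def intro: computes.succ)

lemma recursive_const: "recursive n (\<lambda>xs. c)"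
proof (induction c)
  case 0
  show ?case unfolding recursive_def by (blast intro: computes.zero)
qed (rule recursive_Suc)

text \<open>The order counter, previous value, parameters is the one in which \<open>RPrim\<close>
  feeds its step program.\<close>

lemma recursive_prim:
  assumes "recursive n B" "recursive (Suc (Suc n)) S"
  shows "recursive (Suc n) (\<lambda>xs. rec_nat (B (tl xs)) (\<lambda>m y. S (m # y # tl xs)) (hd xs))"
proof -
  obtain p q where p: "\<And>xs. length xs = n \<Longrightarrow> computes p xs (B xs)"
    and q: "\<And>xs. length xs = Suc (Suc n) \<Longrightarrow> computes q xs (S xs)"
    using assms unfolding recursive_def by blast
  have "computes (RPrim p q) (m # xs) (rec_nat (B xs) (\<lambda>m y. S (m # y # xs)) m)"
    if "length xs = n" for m xs
  proof (induction m)
    case 0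
    show ?case using p[OF that] by (simp add: prim_0)
  next
    case (Suc m)
    from prim_Suc[OF this q] show ?case using that by simp
  qed
  then have "computes (RPrim p q) xs (rec_nat (B (tl xs)) (\<lambda>m y. S (m # y # tl xs)) (hd xs))"
    if "length xs = Suc n" for xs
    using that by (cases xs) auto
  then show ?thesis unfolding recursive_def by blast
qed

lemma recursive_Least:
  assumes "recursive (Suc n) F" "\<And>xs. length xs = n \<Longrightarrow> \<exists>m. F (m # xs) = 0"
  shows "recursive n (\<lambda>xs. LEAST m. F (m # xs) = 0)"
proof -
  obtain p where p: "\<And>xs. length xs = Suc n \<Longrightarrow> computes p xs (F xs)"
    using assms(1) unfolding recursive_def by blast
  have "computes (RMu p) xs (LEAST m. F (m # xs) = 0)" if len: "length xs = n" for xs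
  proof (rule computes.mu)
    show "computes p ((LEAST m. F (m # xs) = 0) # xs) 0"
      using p[of "(LEAST m. F (m # xs) = 0) # xs"] LeastI_ex[OF assms(2)[OF len]] len by simp
    \<comment> \<open>Totality of \<open>p\<close> supplies the values below the minimum that rule
      \<open>mu\<close> demands; minimality makes them positive.\<close>
    show "\<exists>k. computes p (m # xs) (Suc k)" if "m < (LEAST m. F (m # xs) = 0)" for m
      using p[of "m # xs"] not_less_Least[OF that] len by (auto simp: gr0_conv_Suc)
  qed
  then show ?thesis unfolding recursive_def by blast
qed

section \<open>Iteration and arithmetic\<close>

lemma total_recursive2_prim:
  assumes "total_recursive b" "recursive 3 (\<lambda>xs. s (xs ! 0) (xs ! 1) (xs ! 2))"
  shows "total_recursive2 (\<lambda>n x. rec_nat (b x) (\<lambda>m y. s m y x) n)"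
proof -
  have "recursive (Suc 1) (\<lambda>xs. rec_nat (b (tl xs ! 0))
          (\<lambda>m y. s ((m # y # tl xs) ! 0) ((m # y # tl xs) ! 1) ((m # y # tl xs) ! 2)) (hd xs))"
    using assms by (intro recursive_prim) (simp_all add: total_recursive_iff numeral_3_eq_3)
  then have "recursive 2 (\<lambda>xs. rec_nat (b (xs ! 1)) (\<lambda>m y. s m y (xs ! 1)) (xs ! 0))"
    unfolding Suc_1 by (rule recursive_cong) (auto simp: hd_conv_nth nth_tl simp flip: length_0_conv)
  then show ?thesis by (simp add: total_recursive2_iff)
qed

lemma total_recursive_Least:
  assumes "total_recursive2 F" "\<And>x. \<exists>y. F y x = 0"
  shows "total_recursive (\<lambda>x. LEAST y. F y x = 0)"
  using recursive_Least[of 1 "\<lambda>xs. F (xs ! 0) (xs ! 1)"] assms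
  by (simp add: total_recursive_iff total_recursive2_iff numeral_2_eq_2)

lemma total_recursive_ident: "total_recursive (\<lambda>x. x)"
  by (simp add: total_recursive_iff recursive_nth)

lemma total_recursive_const: "total_recursive (\<lambda>x. c)"
  by (simp add: total_recursive_iff recursive_const)

lemma total_recursive2_funpow:
  assumes "total_recursive f"
  shows "total_recursive2 (\<lambda>n x. (f ^^ n) x)"
proof -
  have "rec_nat x (\<lambda>m y. f y) n = (f ^^ n) x" for n x
    by (induction n) simp_all
  moreover have "recursive 3 (\<lambda>xs. f (xs ! 1))"
    by (intro recursive_app1[OF assms] recursive_nth) simp
  ultimately show ?thesis
    using total_recursive2_prim[OF total_recursive_ident, of "\<lambda>m y x. f y"] by simp
qed

lemma total_recursive_Suc: "total_recursive Suc"
  unfolding total_recursive_iff by (intro recursive_Suc recursive_nth) simp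

lemma total_recursive_pred: "total_recursive (\<lambda>x. x - 1)"
proof -
  have "rec_nat 0 (\<lambda>m y. m) n = n - 1" for n
    by (cases n) simp_all
  then have "total_recursive2 (\<lambda>n x. n - 1)"
    using total_recursive2_prim[OF total_recursive_const[of 0], of "\<lambda>m y x. m"]
    by (simp add: recursive_nth)
  \<comment> \<open>The recursion scheme yields a binary function; feeding one argument twice
    removes the dummy parameter.\<close>
  from recursive_app2[OF this, of 1 "\<lambda>xs. xs ! 0" "\<lambda>xs. xs ! 0"] show ?thesis
    by (simp add: total_recursive_iff recursive_nth)
qed

lemma recursive_add:
  assumes "recursive n F" "recursive n G"
  shows "recursive n (\<lambda>xs. F xs + G xs)"
  using recursive_app2[OF total_recursive2_funpow[OF total_recursive_Suc] assms] by simp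

text \<open>Truncated subtraction iterates the predecessor, which stays at 0.\<close>

lemma recursive_diff:
  assumes "recursive n F" "recursive n G"
  shows "recursive n (\<lambda>xs. F xs - G xs)"
proof -
  have "((\<lambda>x. x - 1) ^^ k) m = m - k" for k m :: nat
    by (induction k) simp_all
  then show ?thesis
    using recursive_app2[OF total_recursive2_funpow[OF total_recursive_pred] assms(2,1)] by simp
qed

section \<open>Case distinction, decidable predicates and search\<close>

lemma recursive_if:
  assumes "recursive n (\<lambda>xs. if P xs then 1 else 0)" "recursive n F" "recursive n G"
  shows "recursive n (\<lambda>xs. if P xs then F xs else G xs)"
proof -
  \<comment> \<open>Recursion on the indicator: value 0 returns the base \<open>G\<close>, value 1
    performs one step and returns \<open>F\<close>.\<close>
  have "recursive (Suc n) (\<lambda>xs. rec_nat (G (tl xs)) (\<lambda>m y. F (drop 2 (m # y # tl xs))) (hd xs))"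
  proof (rule recursive_prim[OF assms(3)])
    \<comment> \<open>The step also receives the counter and the previous value; the projections
      discard both.\<close>
    have "recursive (Suc (Suc n)) (\<lambda>xs. F (map (\<lambda>G. G xs) (map (\<lambda>i xs. xs ! Suc (Suc i)) [0..<n])))"
      using assms(2) by (intro recursive_comp) (auto intro: recursive_nth)
    then show "recursive (Suc (Suc n)) (\<lambda>xs. F (drop 2 xs))"
      by (rule recursive_cong) (auto intro!: arg_cong[of _ _ F] nth_equalityI)
  qed
  then have rc: "recursive (Suc n) (\<lambda>xs. rec_nat (G (tl xs)) (\<lambda>m y. F (tl xs)) (hd xs))"
    by (simp add: numeral_2_eq_2)
  define Gs where "Gs = (\<lambda>xs. if P xs then 1 else 0) # map (\<lambda>i xs. xs ! i) [0..<n]"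
  have tl: "map (\<lambda>G. G xs) (tl Gs) = xs" if "length xs = n" for xs
    using that by (auto simp: Gs_def intro!: nth_equalityI)
  have "recursive n (\<lambda>xs. (\<lambda>xs. rec_nat (G (tl xs)) (\<lambda>m y. F (tl xs)) (hd xs)) (map (\<lambda>G. G xs) Gs))"
    using rc assms(1) by (intro recursive_comp) (auto simp: Gs_def intro: recursive_nth)
  then show ?thesis
    by (rule recursive_cong) (use tl in \<open>auto simp: Gs_def\<close>)
qed

text \<open>The indicator is \<open>1 - (Suc F - G)\<close> in truncated subtraction: the inner
  difference vanishes exactly when \<open>F\<close> is below \<open>G\<close>.\<close>

lemma recursive_less:
  assumes "recursive n F" "recursive n G"
  shows "recursive n (\<lambda>xs. if F xs < G xs then 1 else 0)"
  by (rule recursive_cong[OF recursive_diff[OF recursive_const[of _ 1]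
            recursive_diff[OF recursive_Suc[OF assms(1)] assms(2)]]]) auto

lemma recursive_not:
  assumes "recursive n (\<lambda>xs. if P xs then 1 else 0)"
  shows "recursive n (\<lambda>xs. if \<not> P xs then 1 else 0)"
  using recursive_if[OF assms recursive_const[of _ 0] recursive_const[of _ 1]]
  by (rule recursive_cong) auto

lemma recursive_conj:
  assumes "recursive n (\<lambda>xs. if P xs then 1 else 0)" "recursive n (\<lambda>xs. if Q xs then 1 else 0)"
  shows "recursive n (\<lambda>xs. if P xs \<and> Q xs then 1 else 0)"
  using recursive_if[OF assms recursive_const[of _ 0]]
  by (rule recursive_cong) auto

lemma recursive_eq:
  assumes "recursive n F" "recursive n G"
  shows "recursive n (\<lambda>xs. if F xs = G xs then 1 else 0)"
  using recursive_conj[OF recursive_not[OF recursive_less[OF assms]]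
      recursive_not[OF recursive_less[OF assms(2,1)]]]
  by (rule recursive_cong) auto

text \<open>Minimisation looks for a zero, so it runs on the indicator of the negated
  relation.\<close>

lemma recursive_Least_pred:
  assumes "recursive 2 (\<lambda>xs. if R (xs ! 0) (xs ! 1) then 1 else 0)" "\<And>x. \<exists>y. R y x"
  shows "total_recursive (\<lambda>x. LEAST y. R y x)"
proof -
  have "total_recursive2 (\<lambda>y x. if \<not> R y x then 1 else 0)"
    using recursive_not[OF assms(1)] by (simp add: total_recursive2_iff)
  moreover have "(if \<not> R y x then 1 else 0 :: nat) = 0 \<longleftrightarrow> R y x" for x y
    by simp
  ultimately show ?thesis
    using total_recursive_Least[of "\<lambda>y x. if \<not> R y x then 1 else 0"] assms(2)
    by presburger
qed

text \<open>The count is a primitive recursion on a free bound, with \<open>x\<close> as parameter;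
  only at the end is the bound set to \<open>x\<close>.\<close>

lemma total_recursive_card:
  assumes "decidable_rel R"
  shows "total_recursive (\<lambda>x. card {y. R x y \<and> y < x})"
proof -
  have "recursive 3 (\<lambda>xs. xs ! 1 + (if R (xs ! 2) (xs ! 0) then 1 else 0))"
    by (intro recursive_add recursive_app2[OF assms[unfolded decidable_rel_def]] recursive_nth)
      simp_all
  from total_recursive2_prim[OF total_recursive_const[of 0],
      of "\<lambda>m y x. y + (if R x m then 1 else 0)", OF this]
  have rc: "total_recursive2 (\<lambda>n x. rec_nat 0 (\<lambda>m y. y + (if R x m then 1 else 0)) n)" .
  have "rec_nat 0 (\<lambda>m y. y + (if R x m then 1 else 0)) n = card {y. R x y \<and> y < n}" for n x
  proof (induction n)
    case (Suc n)
    have "{y. R x y \<and> y < Suc n} =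
        (if R x n then insert n {y. R x y \<and> y < n} else {y. R x y \<and> y < n})"
      by (auto simp: less_Suc_eq)
    then show ?case using Suc by simp
  qed simp
  with rc have "total_recursive2 (\<lambda>n x. card {y. R x y \<and> y < n})" by simp
  from recursive_app2[OF this, of 1 "\<lambda>xs. xs ! 0" "\<lambda>xs. xs ! 0"] show ?thesis
    by (simp add: total_recursive_iff recursive_nth)
qed

text \<open>The inverse is found by searching for a preimage: surjectivity makes the search halt,
  injectivity makes its result the right one.\<close>

lemma rec_perms_inv:
  assumes "f \<in> rec_perms"
  shows "inv f \<in> rec_perms"
proof -
  have f: "bij f" "total_recursive f" using assms by (auto simp: rec_perms_def)
  have "total_recursive (\<lambda>x. LEAST y. f y = x)"
  proof (rule recursive_Least_pred)
    show "recursive 2 (\<lambda>xs. if f (xs ! 0) = xs ! 1 then 1 else 0)"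
      by (intro recursive_eq recursive_app1[OF f(2)] recursive_nth) simp_all
  qed (metis f(1) bij_pointE)
  moreover have "(LEAST y. f y = x) = inv f x" for x
    using f(1) by (intro Least_equality) (auto simp: bij_inv_eq_iff surj_f_inv_f bij_is_surj bij_is_inj)
  ultimately show ?thesis using bij_imp_bij_inv[OF f(1)] by (simp add: rec_perms_def)
qed

lemma rec_perms_comp:
  assumes "f \<in> rec_perms" "g \<in> rec_perms"
  shows "f \<circ> g \<in> rec_perms"
proof -
  have "total_recursive (\<lambda>x. f (g x))"
    using recursive_app1[of f 1 "\<lambda>xs. g (xs ! 0)"] assms
    by (simp add: rec_perms_def total_recursive_iff)
  then show ?thesis
    using assms bij_comp[of g f] by (simp add: rec_perms_def comp_def)
qed

section \<open>Cycles and semi-normal forms\<close>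

lemma int_iter_Suc:
  assumes "bij f"
  shows "int_iter f (k + 1) x = f (int_iter f k x)"
proof (cases "0 \<le> k")
  case True
  then show ?thesis by (simp add: int_iter_def nat_add_distrib)
next
  case False
  \<comment> \<open>A negative \<open>k\<close> leaves at least one factor \<open>inv f\<close>, and
    \<open>f\<close> cancels the outermost one.\<close>
  then obtain m where "nat (- k) = Suc m" "k = - int (Suc m)"
    by (metis gr0_conv_Suc int_nat_eq linorder_not_le minus_minus neg_0_le_iff_le nat_0_le
        order_le_less zero_less_nat_eq neg_less_0_iff_less)
  then show ?thesis
    using assms by (auto simp: int_iter_def surj_f_inv_f bij_is_surj)
qed

lemma int_iter_of_nat [simp]: "int_iter f (int n) = f ^^ n"
  by (simp add: int_iter_def)

lemma int_iter_0 [simp]: "int_iter f 0 x = x"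
  by (simp add: int_iter_def)

text \<open>Two-sided induction on \<open>k\<close>. In the downward step the two sides are compared
  after one application of \<open>f\<close>, which injectivity cancels.\<close>

lemma int_iter_add:
  assumes "bij f"
  shows "int_iter f (k + l) x = int_iter f k (int_iter f l x)"
proof (induction k rule: int_induct[where k = 0])
  case (step1 i)
  then show ?case
    using int_iter_Suc[OF assms, of "i + l"] int_iter_Suc[OF assms, of i]
    by (simp add: add.assoc add.commute add.left_commute)
next
  case (step2 i)
  have "f (int_iter f (i - 1 + l) x) = f (int_iter f (i - 1) (int_iter f l x))"
    using int_iter_Suc[OF assms, of "i - 1 + l"] int_iter_Suc[OF assms, of "i - 1"] step2.IH
    by (simp add: algebra_simps)
  then show ?case by (simp add: inj_eq[OF bij_is_inj[OF assms]])
qed simp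

lemma int_iter_conj:
  assumes "bij f" "bij h"
  shows "int_iter (inv h \<circ> f \<circ> h) k x = inv h (int_iter f k (h x))"
proof -
  define g where "g = inv h \<circ> f \<circ> h"
  have g: "bij g" using assms by (simp add: g_def bij_comp bij_imp_bij_inv)
  have hg: "h (g y) = f (h y)" for y
    using assms(2) by (simp add: g_def bij_is_surj surj_f_inv_f)
  have "h (int_iter g k x) = int_iter f k (h x)"
  proof (induction k rule: int_induct[where k = 0])
    case (step1 i)
    then show ?case by (simp add: int_iter_Suc[OF g] int_iter_Suc[OF assms(1)] hg)
  next
    case (step2 i)
    have "f (h (int_iter g (i - 1) x)) = f (int_iter f (i - 1) (h x))"
      using int_iter_Suc[OF g, of "i - 1" x] int_iter_Suc[OF assms(1), of "i - 1" "h x"] step2.IH hg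
      by (metis diff_add_cancel)
    then show ?case by (simp add: inj_eq[OF bij_is_inj[OF assms(1)]])
  qed simp
  then show ?thesis using assms(2) unfolding g_def by (metis bij_inv_eq_iff)
qed

section \<open>Cycles and periods\<close>

lemma int_iter_in_perm_cycle [simp]: "int_iter f k x \<in> perm_cycle f x"
  by (auto simp: perm_cycle_def)

lemma perm_cycle_refl [simp]: "x \<in> perm_cycle f x"
  using int_iter_in_perm_cycle[of f 0 x] by simp

lemma perm_cycle_not_empty [simp]: "perm_cycle f x \<noteq> {}"
  using perm_cycle_refl by fast

lemma funpow_in_perm_cycle [simp]: "(f ^^ j) x \<in> perm_cycle f x"
  using int_iter_in_perm_cycle[of f "int j" x] by simp

lemma perm_cycle_eq:
  assumes "bij f" "y \<in> perm_cycle f x"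
  shows "perm_cycle f y = perm_cycle f x"
proof -
  obtain k where y: "y = int_iter f k x" using assms(2) by (auto simp: perm_cycle_def)
  have "int_iter f l y = int_iter f (l + k) x" "int_iter f l x = int_iter f (l - k) y" for l
    using int_iter_add[OF assms(1), of l k x] int_iter_add[OF assms(1), of "l - k" k x]
    by (simp_all add: y)
  then have "int_iter f l y \<in> perm_cycle f x" "int_iter f l x \<in> perm_cycle f y" for l
    using int_iter_in_perm_cycle[of f "l + k" x] int_iter_in_perm_cycle[of f "l - k" y]
    by presburger+
  then show ?thesis unfolding perm_cycle_def[of f y] perm_cycle_def[of f x] by auto
qed

lemma perm_cycle_eq_iff:
  "bij f \<Longrightarrow> perm_cycle f y = perm_cycle f x \<longleftrightarrow> y \<in> perm_cycle f x"
  using perm_cycle_eq[of f y x] perm_cycle_refl[of y f] by blast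

lemma Part_eq_perm_cycle:
  "bij f \<Longrightarrow> C \<in> Part f \<Longrightarrow> x \<in> C \<Longrightarrow> C = perm_cycle f x"
  by (auto simp: Part_def dest: perm_cycle_eq)

lemma perm_cycle_in_Part [simp]: "perm_cycle f x \<in> Part f"
  by (auto simp: Part_def)

lemma Part_Least:
  fixes f :: "nat \<Rightarrow> nat"
  assumes "bij f" "C \<in> Part f"
  shows "C = perm_cycle f (LEAST x. x \<in> C)"
proof (rule Part_eq_perm_cycle[OF assms])
  obtain x where "C = perm_cycle f x" using assms(2) by (auto simp: Part_def)
  then have "x \<in> C" by simp
  then show "(LEAST x. x \<in> C) \<in> C" by (rule LeastI)
qed

lemma block_of_Part:
  assumes "bij f"
  shows "block_of x (Part f) = perm_cycle f x"
  unfolding block_of_def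
proof (rule the_equality)
  show "B = perm_cycle f x" if "B \<in> Part f \<and> x \<in> B" for B
    using that by (intro Part_eq_perm_cycle[OF assms]) simp_all
qed simp

text \<open>All integer multiples of a period fix \<open>x\<close>, so exponents may be reduced
  modulo \<open>n\<close>. The period may be non-minimal, hence an image without
  injectivity.\<close>

lemma perm_cycle_period:
  assumes "bij f" "0 < n" "(f ^^ n) x = x"
  shows "perm_cycle f x = (\<lambda>j. (f ^^ j) x) ` {..<n}"
proof -
  have 1: "int_iter f (int m * int n) x = x" for m
  proof (induction m)
    case (Suc m)
    then show ?case
      using int_iter_add[OF assms(1), of "int m * int n" "int n" x] assms(3)
      by (simp add: algebra_simps)
  qed simp
  have 2: "int_iter f (k * int n) x = x" for k
  proof (cases "0 \<le> k")
    case True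
    then show ?thesis using 1[of "nat k"] by simp
  next
    case False
    then have "int_iter f (- k * int n) x = x" using 1[of "nat (- k)"] by simp
    then show ?thesis
      using int_iter_add[OF assms(1), of "k * int n" "- k * int n" x] by simp
  qed
  have "int_iter f k x = (f ^^ nat (k mod int n)) x" for k
    using int_iter_add[OF assms(1), of "k mod int n" "k div int n * int n" x] 2 assms(2)
    by (simp add: int_iter_def[of f "k mod int n"])
  moreover have "nat (k mod int n) < n" for k
    using assms(2) by (simp add: nat_less_iff)
  ultimately have "perm_cycle f x \<subseteq> (\<lambda>j. (f ^^ j) x) ` {..<n}"
    unfolding perm_cycle_def by blast
  then show ?thesis by auto
qed

text \<open>Two equal iterates would give a positive period, and a point with a positive period has
  a finite cycle.\<close>

lemma inj_int_iter:
  assumes "bij f" "infinite (perm_cycle f x)"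
  shows "inj (\<lambda>k. int_iter f k x)"
proof (rule linorder_injI)
  fix k l :: int assume kl: "k < l"
  show "int_iter f k x \<noteq> int_iter f l x"
  proof
    assume eq: "int_iter f k x = int_iter f l x"
    have "int_iter f (l - k) x = x"
      using int_iter_add[OF assms(1), of "- k" k x] int_iter_add[OF assms(1), of "- k" l x] eq by simp
    then have "(f ^^ nat (l - k)) x = x" using kl by (simp add: int_iter_def)
    then show False
      using perm_cycle_period[OF assms(1), of "nat (l - k)" x] kl assms(2) by simp
  qed
qed

text \<open>By pigeonhole two forward iterates coincide, so a positive period exists; the least one
  equals the cardinality. This is what makes cycle lengths accessible to a search.\<close>

lemma finite_perm_cycle:
  assumes "bij f" "finite (perm_cycle f x)"
  shows "bij_betw (\<lambda>j. (f ^^ j) x) {..<card (perm_cycle f x)} (perm_cycle f x)"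
    and "(f ^^ card (perm_cycle f x)) x = x"
    and "0 < j \<Longrightarrow> (f ^^ j) x = x \<Longrightarrow> card (perm_cycle f x) \<le> j"
proof -
  let ?P = "\<lambda>n. 0 < n \<and> (f ^^ n) x = x"
  have shift: "\<exists>n. ?P n \<and> n \<le> j - i" if "(f ^^ i) x = (f ^^ j) x" "i < j" for i j
  proof -
    have "(f ^^ i) ((f ^^ (j - i)) x) = (f ^^ i) x"
      using that by (metis comp_apply funpow_add le_add_diff_inverse less_imp_le)
    then have "(f ^^ (j - i)) x = x"
      using assms(1) by (meson bij_fn bij_is_inj inj_eq)
    then show ?thesis using that(2) by (intro exI[of _ "j - i"]) simp
  qed
  have "(\<lambda>j. (f ^^ j) x) ` UNIV \<subseteq> perm_cycle f x"
    by auto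
  then have "\<not> inj (\<lambda>j. (f ^^ j) x)"
    using assms(2) by (meson finite_imageD finite_subset infinite_UNIV_nat)
  then obtain u v where "u < v" "(f ^^ u) x = (f ^^ v) x"
    by (metis linorder_injI)
  with shift have ex: "\<exists>n. ?P n" by blast
  define n where "n = (LEAST n. ?P n)"
  have n: "?P n" unfolding n_def by (rule LeastI_ex[OF ex])
  have least: "n \<le> m" if "?P m" for m unfolding n_def using that by (rule Least_le)
  have inj: "inj_on (\<lambda>j. (f ^^ j) x) {..<n}"
  proof (rule linorder_inj_onI)
    fix i j assume "i < j" "i \<in> {..<n}" "j \<in> {..<n}"
    then show "(f ^^ i) x \<noteq> (f ^^ j) x" using shift[of i j] least by fastforce
  qed auto
  have im: "perm_cycle f x = (\<lambda>j. (f ^^ j) x) ` {..<n}"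
    using perm_cycle_period[OF assms(1)] n by blast
  then have card: "card (perm_cycle f x) = n" using card_image[OF inj] by simp
  show "bij_betw (\<lambda>j. (f ^^ j) x) {..<card (perm_cycle f x)} (perm_cycle f x)"
    unfolding card using inj im by (simp add: bij_betw_def)
  show "(f ^^ card (perm_cycle f x)) x = x" using n card by simp
  show "0 < j \<Longrightarrow> (f ^^ j) x = x \<Longrightarrow> card (perm_cycle f x) \<le> j" using least card by simp
qed

section \<open>The coding of the integers\<close>

lemma bij_zdelta: "bij zdelta"
proof (rule bijI)
  have z: "int (zdelta k) = (if 0 \<le> k then 2 * k else - 2 * k - 1)" for k
    by (simp add: zdelta_def)
  show "inj zdelta"
  proof (rule injI)
    fix x y assume "zdelta x = zdelta y"
    then have "int (zdelta x) = int (zdelta y)" by simp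
    then show "x = y" unfolding z by presburger
  qed
  have "\<exists>k. n = zdelta k" for n
  proof (cases "even n")
    case True
    then have "n = zdelta (int (n div 2))" by (auto simp: zdelta_def elim!: evenE)
    then show ?thesis ..
  next
    case False
    \<comment> \<open>Odd numbers code the negative integers: \<open>- 2 * k - 1 = n\<close> gives
      this \<open>k\<close>.\<close>
    then have "n = zdelta (- int ((n + 1) div 2))"
      by (auto simp: zdelta_def elim!: oddE)
    then show ?thesis ..
  qed
  then show "surj zdelta" by (simp add: surj_def)
qed

lemma inv_zdelta_0: "inv zdelta 0 = 0"
  by (rule inv_f_eq[OF bij_is_inj[OF bij_zdelta]]) (simp add: zdelta_def)

section \<open>Ranks and traversals of a cycle\<close>

definition rank :: "'a::linorder set \<Rightarrow> 'a \<Rightarrow> nat" where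
  "rank C x = card {y \<in> C. y < x}"

text \<open>Both the range of \<open>rank C\<close> on \<open>C\<close> and the index set of a
  traversal, so that finite and infinite cycles share one formulation.\<close>

definition ranks :: "'a set \<Rightarrow> nat set" where
  "ranks C = (if finite C then {..<card C} else UNIV)"

text \<open>For a cycle \<open>C\<close> of \<open>f\<close> this is the sequence that
  semi-normality requires to increase. On an infinite cycle the exponents run through 0, -1, 1, -2,
  and so on.\<close>

definition traverse :: "(nat \<Rightarrow> nat) \<Rightarrow> nat set \<Rightarrow> nat \<Rightarrow> nat" where
  "traverse f C j = (let a = LEAST x. x \<in> C in
     if finite C then (f ^^ j) a else int_iter f (inv zdelta j) a)"

lemma traverse_0: "traverse f C 0 = (LEAST x. x \<in> C)"
  by (simp add: traverse_def Let_def inv_zdelta_0)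

lemma rank_Least: "rank C (LEAST x. x \<in> C) = 0" for C :: "nat set"
proof -
  have "{y \<in> C. y < (LEAST x. x \<in> C)} = {}" using not_less_Least by blast
  then show ?thesis by (simp add: rank_def)
qed

lemma rank_less:
  fixes C :: "nat set"
  assumes "x \<in> C" "x < y"
  shows "rank C x < rank C y"
  unfolding rank_def using assms by (intro psubset_card_mono) auto

lemma rank_less_iff:
  fixes C :: "nat set"
  assumes "x \<in> C" "y \<in> C"
  shows "rank C x < rank C y \<longleftrightarrow> x < y"
  using rank_less[OF assms(1), of y] rank_less[OF assms(2), of x] by (cases x y rule: linorder_cases) auto

lemma rank_inj:
  fixes C :: "nat set"
  assumes "x \<in> C" "y \<in> C" "rank C x = rank C y"
  shows "x = y"
  using rank_less_iff[OF assms(1,2)] rank_less_iff[OF assms(2,1)] assms(3) by simp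

text \<open>Since \<open>t\<close> is onto and increasing, and \<open>ranks C\<close> is closed
  downwards, the elements of \<open>C\<close> below \<open>t j\<close> are the \<open>t i\<close>
  with \<open>i < j\<close>. An increasing listing is thus determined by \<open>C\<close>
  alone.\<close>

lemma rank_strict_mono:
  assumes "bij_betw t (ranks C) C" "strict_mono_on (ranks C) t" "j \<in> ranks C"
  shows "rank C (t j) = j"
proof -
  have sub: "{..<j} \<subseteq> ranks C" using assms(3) by (auto simp: ranks_def split: if_splits)
  have "{y \<in> C. y < t j} = t ` {..<j}"
  proof (intro equalityI subsetI)
    fix y assume "y \<in> {y \<in> C. y < t j}"
    then obtain i where "i \<in> ranks C" "y = t i" "t i < t j"
      using assms(1) by (metis (no_types, lifting) bij_betw_imp_surj_on imageE mem_Collect_eq)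
    then show "y \<in> t ` {..<j}"
      using assms(2,3) by (auto simp: strict_mono_on_less)
  next
    fix y assume "y \<in> t ` {..<j}"
    then show "y \<in> {y \<in> C. y < t j}"
      using sub assms by (auto simp: bij_betw_def strict_mono_on_less)
  qed
  moreover have "inj_on t {..<j}"
    using assms(1) sub by (meson bij_betw_def inj_on_subset)
  ultimately show ?thesis by (simp add: rank_def card_image)
qed

lemma bij_betw_enumerate_ranks:
  fixes C :: "nat set"
  shows "bij_betw (enumerate C) (ranks C) C" "strict_mono_on (ranks C) (enumerate C)"
  by (auto simp: ranks_def bij_enumerate finite_bij_enumerate strict_mono_on_def
      enumerate_mono finite_enumerate_mono)

text \<open>The enumeration of \<open>C\<close> is an increasing listing, so \<open>rank C\<close>
  is its inverse.\<close>

lemma bij_betw_rank: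
  fixes C :: "nat set"
  shows "bij_betw (rank C) C (ranks C)"
proof -
  note e = bij_betw_enumerate_ranks[of C]
  have "\<exists>j \<in> ranks C. rank C x = j \<and> x = enumerate C j" if "x \<in> C" for x
    using that bij_betw_imp_surj_on[OF e(1)] rank_strict_mono[OF e] by (metis imageE)
  moreover have "j \<in> rank C ` C" if "j \<in> ranks C" for j
    using bij_betwE[OF e(1)] rank_strict_mono[OF e that] that by (metis image_eqI)
  moreover have "inj_on (rank C) C"
    by (rule inj_onI) (rule rank_inj)
  ultimately show ?thesis
    unfolding bij_betw_def by blast
qed

lemma bij_betw_traverse:
  assumes "bij f" "C \<in> Part f"
  shows "bij_betw (traverse f C) (ranks C) C"
proof -
  define a where "a = (LEAST x. x \<in> C)"
  have C: "C = perm_cycle f a" unfolding a_def by (rule Part_Least[OF assms])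
  show ?thesis
  proof (cases "finite C")
    case True
    then show ?thesis
      using finite_perm_cycle(1)[OF assms(1), of a]
      unfolding C[symmetric] by (simp add: traverse_def[abs_def] ranks_def a_def)
  next
    case False
    have "bij_betw (\<lambda>k. int_iter f k a) UNIV C"
      using inj_int_iter[OF assms(1), of a] False unfolding C
      by (auto simp: bij_betw_def perm_cycle_def)
    from bij_betw_trans[OF bij_imp_bij_inv[OF bij_zdelta] this] False show ?thesis
      by (simp add: traverse_def[abs_def] ranks_def comp_def a_def)
  qed
qed

section \<open>Semi-normal permutations and their uniqueness\<close>

lemma semi_normal_iff:
  "semi_normal g \<longleftrightarrow> bij g \<and> (\<forall>C \<in> Part g. strict_mono_on (ranks C) (traverse g C))"
proof -
  have "(let a = LEAST x. x \<in> C in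
        (infinite C \<longrightarrow> strict_mono (\<lambda>j. int_iter g (inv zdelta j) a)) \<and>
        (finite C \<longrightarrow> strict_mono_on {0..<card C} (\<lambda>j. (g ^^ j) a)))
      \<longleftrightarrow> strict_mono_on (ranks C) (traverse g C)" for C
    by (cases "finite C") (simp_all add: ranks_def traverse_def[abs_def] Let_def atLeast0LessThan)
  then show ?thesis unfolding semi_normal_def by simp
qed

lemma rank_traverse:
  assumes "semi_normal g" "C \<in> Part g" "j \<in> ranks C"
  shows "rank C (traverse g C j) = j"
proof -
  have "bij g" "strict_mono_on (ranks C) (traverse g C)"
    using assms(1,2) by (simp_all add: semi_normal_iff)
  then show ?thesis using rank_strict_mono bij_betw_traverse assms(2,3) by blast
qed

text \<open>How a permutation moves the positions of its traversal, without reference to the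
  permutation: the cyclic shift, or the shift by one on the integers carried through
  \<open>zdelta\<close>.\<close>

definition next_rank :: "nat set \<Rightarrow> nat \<Rightarrow> nat" where
  "next_rank C j = (if finite C then Suc j mod card C else zdelta (inv zdelta j + 1))"

lemma next_rank_in_ranks: "j \<in> ranks C \<Longrightarrow> next_rank C j \<in> ranks C"
  by (auto simp: ranks_def next_rank_def)

lemma traverse_next_rank:
  assumes "bij g" "C \<in> Part g" "j \<in> ranks C"
  shows "g (traverse g C j) = traverse g C (next_rank C j)"
proof (cases "finite C")
  case True
  define a where "a = (LEAST x. x \<in> C)"
  have C: "C = perm_cycle g a" unfolding a_def by (rule Part_Least[OF assms(1,2)])
  have j: "Suc j \<le> card C" using assms(3) True by (simp add: ranks_def)
  \<comment> \<open>At the last position the remainder is 0, matching the return of the cycle to its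
    least element.\<close>
  have "(g ^^ Suc j) a = (g ^^ (Suc j mod card C)) a"
  proof (cases "Suc j = card C")
    case eq: True
    have "(g ^^ card C) a = a"
      using finite_perm_cycle(2)[OF assms(1), of a] True unfolding C[symmetric] by simp
    then show ?thesis unfolding eq by simp
  next
    case False
    then show ?thesis using j by simp
  qed
  then show ?thesis using True by (simp add: traverse_def next_rank_def a_def)
next
  case False
  then show ?thesis
    by (simp add: traverse_def next_rank_def Let_def int_iter_Suc[OF assms(1)]
        inv_f_f bij_is_inj[OF bij_zdelta])
qed

text \<open>On a common cycle both traversals list the elements by rank, so they agree; both
  permutations move position \<open>j\<close> to \<open>next_rank C j\<close>, which depends on
  \<open>C\<close> only.\<close>

lemma semi_normal_unique:
  assumes "semi_normal g" "semi_normal g'" "Part g = Part g'"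
  shows "g = g'"
proof
  fix x
  define C where "C = perm_cycle g x"
  have C: "C \<in> Part g" "x \<in> C" by (simp_all add: C_def)
  then have C': "C \<in> Part g'" using assms(3) by simp
  have bij: "bij g" "bij g'" using assms(1,2) by (simp_all add: semi_normal_iff)
  have eq: "traverse g C j = traverse g' C j" if "j \<in> ranks C" for j
  proof (rule rank_inj)
    show "traverse g C j \<in> C" "traverse g' C j \<in> C"
      using bij_betwE[OF bij_betw_traverse[OF bij(1) C(1)]]
        bij_betwE[OF bij_betw_traverse[OF bij(2) C']] that by simp_all
    show "rank C (traverse g C j) = rank C (traverse g' C j)"
      using rank_traverse[OF assms(1) C(1) that] rank_traverse[OF assms(2) C' that] by simp
  qed
  obtain j where j: "j \<in> ranks C" "x = traverse g C j"
    using bij_betw_imp_surj_on[OF bij_betw_traverse[OF bij(1) C(1)]] C(2) by blast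
  have "g x = traverse g C (next_rank C j)"
    using traverse_next_rank[OF bij(1) C(1) j(1)] j(2) by simp
  also have "\<dots> = g' x"
    using traverse_next_rank[OF bij(2) C' j(1)] eq[OF j(1)] eq[OF next_rank_in_ranks[OF j(1)]] j(2)
    by simp
  finally show "g x = g' x" .
qed

section \<open>The conjugating permutation\<close>

definition straighten :: "(nat \<Rightarrow> nat) \<Rightarrow> nat \<Rightarrow> nat" where
  "straighten f x = traverse f (perm_cycle f x) (rank (perm_cycle f x) x)"

lemma bij_betw_straighten:
  assumes "bij f" "C \<in> Part f"
  shows "bij_betw (straighten f) C C"
proof -
  have "bij_betw (traverse f C \<circ> rank C) C C"
    using bij_betw_trans[OF bij_betw_rank bij_betw_traverse[OF assms]] .
  moreover have "straighten f x = (traverse f C \<circ> rank C) x" if "x \<in> C" for x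
    using Part_eq_perm_cycle[OF assms that] by (simp add: straighten_def)
  ultimately show ?thesis
    using bij_betw_cong[of C "straighten f" "traverse f C \<circ> rank C" C] by blast
qed

lemma straighten_in_perm_cycle:
  "bij f \<Longrightarrow> straighten f x \<in> perm_cycle f x"
  using bij_betwE[OF bij_betw_straighten[of f "perm_cycle f x"]] by simp

text \<open>Every cycle is permuted within itself, so the bijections of the single cycles glue
  together.\<close>

lemma bij_straighten:
  assumes "bij f"
  shows "bij (straighten f)"
proof (rule bijI)
  show "inj (straighten f)"
  proof (rule injI)
    fix x y assume eq: "straighten f x = straighten f y"
    then have "perm_cycle f x = perm_cycle f y"
      using perm_cycle_eq[OF assms straighten_in_perm_cycle[OF assms], of x]
        perm_cycle_eq[OF assms straighten_in_perm_cycle[OF assms], of y] by simp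
    then have "y \<in> perm_cycle f x"
      using perm_cycle_refl[of y f] by simp
    then show "x = y"
      using bij_betw_imp_inj_on[OF bij_betw_straighten[OF assms perm_cycle_in_Part[of f x]]] eq
      by (meson inj_onD perm_cycle_refl)
  qed
  show "surj (straighten f)"
  proof -
    have "y \<in> straighten f ` perm_cycle f y" for y
      using bij_betw_imp_surj_on[OF bij_betw_straighten[OF assms perm_cycle_in_Part]] by simp
    then show ?thesis by blast
  qed
qed

text \<open>If \<open>x\<close> has rank \<open>j\<close> in its cycle, \<open>straighten f\<close>
  takes it to term \<open>j\<close> of the traversal by \<open>f\<close>. Pulled back, term
  \<open>j\<close> of the traversal by \<open>g\<close> is \<open>x\<close>, so that traversal
  increases.\<close>

lemma semi_normal_straighten:
  assumes "bij f"
  defines "g \<equiv> inv (straighten f) \<circ> f \<circ> straighten f"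
  shows "semi_normal g" "Part g = Part f"
proof -
  let ?h = "straighten f"
  note h = bij_straighten[OF assms(1)]
  have iter: "int_iter g k x = inv ?h (int_iter f k (?h x))" for k x
    unfolding g_def by (rule int_iter_conj[OF assms(1) h])
  have g: "bij g" unfolding g_def using assms(1) h by (simp add: bij_comp bij_imp_bij_inv)
  \<comment> \<open>Conjugation keeps the cycles because the conjugating map never leaves a cycle of
    \<open>f\<close>.\<close>
  have "perm_cycle g x = perm_cycle f x" for x
  proof -
    have "y \<in> perm_cycle g x \<longleftrightarrow> ?h y \<in> perm_cycle f (?h x)" for y
      unfolding perm_cycle_def iter mem_Collect_eq using h by (metis bij_inv_eq_iff)
    also have "?h y \<in> perm_cycle f (?h x) \<longleftrightarrow> y \<in> perm_cycle f x" for y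
      using perm_cycle_eq_iff[OF assms(1)]
        perm_cycle_eq[OF assms(1) straighten_in_perm_cycle[OF assms(1)]] by metis
    finally show ?thesis by blast
  qed
  then show Part: "Part g = Part f" by (simp add: Part_def)
  have "strict_mono_on (ranks C) (traverse g C)" if "C \<in> Part f" for C
  proof -
    define a where "a = (LEAST x. x \<in> C)"
    have C: "perm_cycle f a = C" unfolding a_def using Part_Least[OF assms(1) that] by simp
    \<comment> \<open>The least element has rank 0 and is term 0 of the traversal, so both
      traversals start at the same point.\<close>
    have ha: "?h a = a"
      by (simp add: straighten_def C) (simp add: a_def rank_Least traverse_0)
    have tr: "traverse g C j = inv ?h (traverse f C j)" for j
      using iter[of "int j" a] iter[of "inv zdelta j" a]
      by (simp add: traverse_def ha a_def[symmetric])
    have rank: "rank C (traverse g C j) = j" if j: "j \<in> ranks C" for j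
    proof -
      obtain x where x: "x \<in> C" "rank C x = j"
        using j bij_betw_imp_surj_on[OF bij_betw_rank[of C]] by (metis imageE)
      then have "?h x = traverse f C j"
        using Part_eq_perm_cycle[OF assms(1) \<open>C \<in> Part f\<close>] by (simp add: straighten_def)
      then have "traverse g C j = x" unfolding tr using h by (metis bij_inv_eq_iff)
      with x show ?thesis by simp
    qed
    have "traverse g C j \<in> C" if "j \<in> ranks C" for j
      using bij_betwE[OF bij_betw_traverse[OF g]] \<open>C \<in> Part f\<close> that Part by simp
    then show ?thesis
      using rank by (intro strict_mono_onI) (metis rank_less_iff)
  qed
  then show "semi_normal g" by (simp add: semi_normal_iff g Part)
qed

lemma semi_normal_form_eqI:
  "semi_normal g \<Longrightarrow> Part g = Part f \<Longrightarrow> semi_normal_form f = g"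
  unfolding semi_normal_form_def by (intro the_equality) (auto intro: semi_normal_unique)

lemma infinite_iff_rank_semi_normal:
  assumes "semi_normal g" "C \<in> Part g" "a = (LEAST x. x \<in> C)"
  shows "infinite C \<longleftrightarrow> 2 \<le> rank C (g a)"
proof -
  have g: "bij g" using assms(1) by (simp add: semi_normal_def)
  have "C \<noteq> {}" using Part_Least[OF g assms(2)] perm_cycle_refl by fastforce
  then have 0: "0 \<in> ranks C" by (auto simp: ranks_def card_gt_0_iff)
  have "traverse g C 0 = a" by (simp add: traverse_0 assms(3))
  then have "g a = traverse g C (next_rank C 0)"
    using traverse_next_rank[OF g assms(2) 0] by simp
  then have "rank C (g a) = next_rank C 0"
    using rank_traverse[OF assms(1,2) next_rank_in_ranks[OF 0]] by simp
  \<comment> \<open>On an infinite cycle position 0 moves to \<open>zdelta 1 = 2\<close>. On a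
    finite one \<open>1 mod card C\<close> is 0 for a fixed point and 1 otherwise.\<close>
  also have "\<dots> = (if finite C then 1 mod card C else 2)"
    by (simp add: next_rank_def inv_zdelta_0 zdelta_def)
  moreover have "1 mod card C \<le> 1" by (rule mod_less_eq_dividend)
  ultimately show ?thesis by auto
qed

section \<open>Effectiveness\<close>

text \<open>Evenness of \<open>j\<close> is phrased by sums, so that the case distinction is visibly recursive.\<close>

lemma inv_zdelta:
  "inv zdelta j = (if j = Suc j div 2 + Suc j div 2 then int (Suc j div 2) else - int (Suc j div 2))"
proof (rule inv_f_eq[OF bij_is_inj[OF bij_zdelta]])
  show "zdelta (if j = Suc j div 2 + Suc j div 2 then int (Suc j div 2)
      else - int (Suc j div 2)) = j"
  proof (cases "even j")
    case True
    then obtain m where "j = 2 * m" ..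
    then show ?thesis by (simp add: zdelta_def)
  next
    case False
    then obtain m where "j = 2 * m + 1" by (rule oddE)
    then show ?thesis by (simp add: zdelta_def)
  qed
qed

text \<open>A search for the least \<open>k\<close> with \<open>k + k\<close> at least
  \<open>j\<close> finds the half rounded up, which is the absolute value of
  \<open>inv zdelta j\<close>.\<close>

lemma total_recursive_half: "total_recursive (\<lambda>j. Suc j div 2)"
proof -
  have "recursive 2 (\<lambda>xs. if \<not> xs ! 0 + xs ! 0 < xs ! 1 then 1 else 0)"
    by (intro recursive_not recursive_less recursive_add recursive_nth) simp_all
  from recursive_Least_pred[of "\<lambda>k j. \<not> k + k < j", OF this]
  have "total_recursive (\<lambda>j. LEAST k. \<not> k + k < j)"
    by (metis le_add1 not_less)
  moreover have "(LEAST k. \<not> k + k < j) = Suc j div 2" for j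
    by (rule Least_equality) auto
  ultimately show ?thesis by simp
qed

text \<open>Programs compute no integers, so \<open>inv zdelta j\<close> is split: its absolute
  value is the number of iterations, its sign chooses between \<open>f\<close> and
  \<open>inv f\<close>.\<close>

lemma total_recursive2_int_iter:
  assumes "f \<in> rec_perms"
  shows "total_recursive2 (\<lambda>j x. int_iter f (inv zdelta j) x)"
proof -
  have f: "total_recursive f" "total_recursive (inv f)"
    using assms rec_perms_inv[OF assms] by (simp_all add: rec_perms_def)
  have half: "recursive 2 (\<lambda>xs. Suc (xs ! 0) div 2)"
    by (intro recursive_app1[OF total_recursive_half] recursive_nth) simp
  have fwd: "recursive 2 (\<lambda>xs. (f ^^ (Suc (xs ! 0) div 2)) (xs ! 1))"
    by (intro recursive_app2[OF total_recursive2_funpow[OF f(1)]] half recursive_nth) simp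
  have bwd: "recursive 2 (\<lambda>xs. (inv f ^^ (Suc (xs ! 0) div 2)) (xs ! 1))"
    by (intro recursive_app2[OF total_recursive2_funpow[OF f(2)]] half recursive_nth) simp
  have "recursive 2 (\<lambda>xs. if xs ! 0 = Suc (xs ! 0) div 2 + Suc (xs ! 0) div 2
      then (f ^^ (Suc (xs ! 0) div 2)) (xs ! 1) else (inv f ^^ (Suc (xs ! 0) div 2)) (xs ! 1))"
    by (rule recursive_if[OF recursive_eq[OF recursive_nth recursive_add[OF half half]] fwd bwd]) simp
  then show ?thesis
    unfolding total_recursive2_iff
    by (rule recursive_cong) (auto simp: inv_zdelta int_iter_def)
qed

section \<open>From decidable finiteness to effective conjugacy\<close>

lemma total_recursive_min_perm_cycle:
  assumes "f \<in> dec_perms"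
  shows "total_recursive (\<lambda>x. LEAST y. y \<in> perm_cycle f x)"
proof (rule recursive_Least_pred)
  have "total_recursive2 (\<lambda>x y. if y \<in> perm_cycle f x then 1 else 0)"
    using assms by (simp add: dec_perms_def decidable_rel_def)
  \<comment> \<open>Minimisation runs over the first argument, but the decision procedure expects
    \<open>x\<close> first, so the arguments are exchanged.\<close>
  then show "recursive 2 (\<lambda>xs. if xs ! 0 \<in> perm_cycle f (xs ! 1) then 1 else 0)"
    by (rule recursive_app2) (simp_all add: recursive_nth)
  show "\<exists>y. y \<in> perm_cycle f x" for x
    by (rule exI[of _ x]) simp
qed

lemma total_recursive_rank_perm_cycle:
  assumes "f \<in> dec_perms"
  shows "total_recursive (\<lambda>x. rank (perm_cycle f x) x)"
  using assms unfolding rank_def dec_perms_def by (intro total_recursive_card) simp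

text \<open>The formulas for finite and for infinite cycles are both total recursive in the rank and
  the least element; decidability of \<open>CF f\<close> selects between them.\<close>

lemma straighten_in_rec_perms:
  assumes "f \<in> dec_perms" "decidable_set (CF f)"
  shows "straighten f \<in> rec_perms"
proof -
  have f: "f \<in> rec_perms" "bij f" "total_recursive f"
    using assms(1) by (simp_all add: dec_perms_def rec_perms_def)
  have CF: "recursive 1 (\<lambda>xs. if xs ! 0 \<in> CF f then 1 else 0)"
    using assms(2) by (simp add: decidable_set_def total_recursive_iff)
  have min: "recursive 1 (\<lambda>xs. LEAST y. y \<in> perm_cycle f (xs ! 0))"
    using total_recursive_min_perm_cycle[OF assms(1)] by (simp add: total_recursive_iff)
  have rank: "recursive 1 (\<lambda>xs. rank (perm_cycle f (xs ! 0)) (xs ! 0))"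
    using total_recursive_rank_perm_cycle[OF assms(1)] by (simp add: total_recursive_iff)
  have "total_recursive (straighten f)"
    unfolding total_recursive_iff
    using recursive_if[OF CF recursive_app2[OF total_recursive2_funpow[OF f(3)] rank min]
        recursive_app2[OF total_recursive2_int_iter[OF f(1)] rank min]]
    by (rule recursive_cong) (simp add: straighten_def traverse_def CF_def)
  then show ?thesis using bij_straighten[OF f(2)] by (simp add: rec_perms_def)
qed

lemma effectively_conjugate_semi_normal_form:
  assumes "f \<in> dec_perms" "decidable_set (CF f)"
  shows "effectively_conjugate f (semi_normal_form f)"
proof -
  let ?h = "straighten f"
  have f: "f \<in> rec_perms" "bij f"
    using assms(1) by (simp_all add: dec_perms_def rec_perms_def)
  have h: "?h \<in> rec_perms" by (rule straighten_in_rec_perms[OF assms])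
  have "semi_normal_form f = inv ?h \<circ> f \<circ> ?h"
    by (intro semi_normal_form_eqI semi_normal_straighten f(2))
  then show ?thesis
    unfolding effectively_conjugate_def using f(1) h rec_perms_comp rec_perms_inv by auto
qed

lemma decidable_CF_semi_normal_form:
  assumes "f \<in> dec_perms" "semi_normal_form f \<in> rec_perms"
  shows "decidable_set (CF f)"
proof -
  define g where "g = semi_normal_form f"
  have f: "bij f" "decidable_rel (\<lambda>x x'. x' \<in> perm_cycle f x)"
    using assms(1) by (simp_all add: dec_perms_def rec_perms_def)
  have g: "semi_normal g" "Part g = Part f"
    using semi_normal_straighten[OF f(1)] semi_normal_form_eqI unfolding g_def by simp_all
  have rg: "total_recursive g" using assms(2) by (simp add: rec_perms_def g_def)
  let ?a = "\<lambda>x. LEAST y. y \<in> perm_cycle f x"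
  \<comment> \<open>Since \<open>f\<close> and \<open>g\<close> have the same cycles, the rank of
    the image of the least element under \<open>g\<close> is computable from the decidable cycle
    relation of \<open>f\<close>.\<close>
  have CF: "x \<in> CF f \<longleftrightarrow> rank (perm_cycle f (g (?a x))) (g (?a x)) < 2" for x
  proof -
    have C: "perm_cycle f x \<in> Part g" by (simp add: g(2))
    have bg: "bij g" using g(1) by (simp add: semi_normal_iff)
    have pc: "perm_cycle g (?a x) = perm_cycle f x" using Part_Least[OF bg C] by simp
    have "g (?a x) \<in> perm_cycle f x"
      using funpow_in_perm_cycle[of 1 g "?a x"] by (simp add: pc)
    then have "perm_cycle f (g (?a x)) = perm_cycle f x" by (rule perm_cycle_eq[OF f(1)])
    with infinite_iff_rank_semi_normal[OF g(1) C refl] show ?thesis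
      by (auto simp: CF_def)
  qed
  have "recursive 1 (\<lambda>xs. ?a (xs ! 0))"
    using total_recursive_min_perm_cycle[OF assms(1)] by (simp add: total_recursive_iff)
  from recursive_app1[OF total_recursive_rank_perm_cycle[OF assms(1)] recursive_app1[OF rg this]]
  have "recursive 1 (\<lambda>xs. if rank (perm_cycle f (g (?a (xs ! 0)))) (g (?a (xs ! 0))) < 2
      then 1 else 0)"
    by (rule recursive_less) (rule recursive_const)
  then show ?thesis
    by (simp add: decidable_set_def total_recursive_iff CF)
qed

text \<open>The length of a finite cycle is the least positive period, which a search finds.\<close>

lemma total_recursive_card_perm_cycle:
  assumes "f \<in> rec_perms" "decidable_set (CF f)"
  shows "total_recursive (\<lambda>x. if infinite (perm_cycle f x) then 0 else card (perm_cycle f x))"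
proof -
  have f: "bij f" "total_recursive f" using assms by (simp_all add: rec_perms_def)
  \<comment> \<open>Outside \<open>CF f\<close> the relation holds already at \<open>n = 0\<close>,
    so the search halts for every \<open>x\<close>.\<close>
  let ?R = "\<lambda>n x. \<not> (x \<in> CF f \<and> \<not> (0 < n \<and> (f ^^ n) x = x))"
  have CF: "recursive 1 (\<lambda>xs. if xs ! 0 \<in> CF f then 1 else 0)"
    using assms(2) by (simp add: decidable_set_def total_recursive_iff)
  have "recursive 2 (\<lambda>xs. if xs ! 1 \<in> CF f then 1 else 0)"
    using assms(2) unfolding decidable_set_def by (rule recursive_app1) (simp add: recursive_nth)
  then have "recursive 2 (\<lambda>xs. if ?R (xs ! 0) (xs ! 1) then 1 else 0)"
    by (intro recursive_not recursive_conj recursive_less recursive_eq recursive_const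
        recursive_app2[OF total_recursive2_funpow[OF f(2)]] recursive_nth) simp_all
  moreover have card: "0 < card (perm_cycle f x)" "(f ^^ card (perm_cycle f x)) x = x"
    if "x \<in> CF f" for x
    using that finite_perm_cycle(2)[OF f(1), of x]
    by (auto simp: CF_def card_gt_0_iff)
  then have "\<exists>n. ?R n x" for x by blast
  ultimately have "total_recursive (\<lambda>x. LEAST n. ?R n x)" by (rule recursive_Least_pred)
  then have "recursive 1 (\<lambda>xs. if xs ! 0 \<in> CF f then LEAST n. ?R n (xs ! 0) else 0)"
    by (intro recursive_if[OF CF] recursive_const) (simp add: total_recursive_iff)
  moreover have "(LEAST n. ?R n x) = card (perm_cycle f x)" if "x \<in> CF f" for x
  proof (rule Least_equality)
    show "?R (card (perm_cycle f x)) x" using card[OF that] by simp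
    show "card (perm_cycle f x) \<le> n" if "?R n x" for n
      using that finite_perm_cycle(3)[OF f(1), of x n] \<open>x \<in> CF f\<close> by (simp add: CF_def)
  qed
  then have "(if x \<in> CF f then LEAST n. ?R n x else 0) =
      (if infinite (perm_cycle f x) then 0 else card (perm_cycle f x))" for x
    by (simp add: CF_def)
  ultimately show ?thesis
    by (simp add: total_recursive_iff)
qed

text \<open>Cycles are nonempty, so the value 0 occurs only for infinite ones.\<close>

lemma decidable_CF_card:
  assumes "total_recursive r"
    and "\<And>x. r x = (if infinite (perm_cycle f x) then 0 else card (perm_cycle f x))"
  shows "decidable_set (CF f)"
proof -
  have "x \<in> CF f \<longleftrightarrow> 0 < r x" for x
    by (simp add: assms(2) CF_def card_gt_0_iff)
  moreover have "recursive 1 (\<lambda>xs. if 0 < r (xs ! 0) then 1 else 0)"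
    by (intro recursive_less recursive_const recursive_app1[OF assms(1)] recursive_nth) simp
  ultimately show ?thesis
    by (simp add: decidable_set_def total_recursive_iff)
qed

theorem theorem4p5:
  fixes f :: "nat \<Rightarrow> nat" and Q :: "nat set set"
  assumes "f \<in> dec_perms" and "Q = Part f"
  shows
    "(decidable_set (CF f) \<longleftrightarrow>
        (\<exists>\<rho>. total_recursive \<rho> \<and>
          (\<forall>x. \<rho> x = (if infinite (block_of x Q) then 0 else card (block_of x Q))))) \<and>
     (decidable_set (CF f) \<longleftrightarrow> effectively_conjugate f (semi_normal_form f))"
proof (intro conjI iffI)
  have f: "f \<in> rec_perms" "bij f" using assms(1) by (simp_all add: dec_perms_def rec_perms_def)
  have block: "block_of x Q = perm_cycle f x" for x
    unfolding assms(2) by (rule block_of_Part[OF f(2)])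
  show "\<exists>\<rho>. total_recursive \<rho> \<and>
      (\<forall>x. \<rho> x = (if infinite (block_of x Q) then 0 else card (block_of x Q)))"
    if "decidable_set (CF f)"
    unfolding block using total_recursive_card_perm_cycle[OF f(1) that]
    by (intro exI[of _ "\<lambda>x. if infinite (perm_cycle f x) then 0 else card (perm_cycle f x)"]) simp
  show "decidable_set (CF f)"
    if "\<exists>\<rho>. total_recursive \<rho> \<and>
      (\<forall>x. \<rho> x = (if infinite (block_of x Q) then 0 else card (block_of x Q)))"
    using that unfolding block by (blast intro: decidable_CF_card)
  show "effectively_conjugate f (semi_normal_form f)" if "decidable_set (CF f)"
    using assms(1) that by (rule effectively_conjugate_semi_normal_form)
  \<comment> \<open>Effective conjugacy includes recursiveness of the semi-normal form, from which
    finiteness is decided.\<close>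
  show "decidable_set (CF f)" if "effectively_conjugate f (semi_normal_form f)"
    using that decidable_CF_semi_normal_form[OF assms(1)] by (simp add: effectively_conjugate_def)
qed

end
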